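(* Let $\mathcal{X}$ be a non-empty finite set, and let $\check n,\hat n\geq1$ be integers with $N=\check n+\hat n$. Let $\check x,\check y\in\mathcal{X}^{\check n}$ and let $\mathcal{R}\subseteq\mathcal{G}(\mathcal{X}^N)$ be a coherent and exchangeable set of gambles on $\mathcal{X}^N$. If $\check y$ is a permutation of $\check x$, or in other words if $T^{\check n}(\check x)=T^{\check n}(\check y)=:\check m$, then $$\mathcal{R}\rfloor\check x=\mathcal{R}\rfloor\check y=\mathcal{R}\rfloor\check m.$$
   Context: A gamble on a non-empty set $\Omega$ is a bounded function $\Omega\to\mathbb{R}$; $\mathcal{G}(\Omega)$ is the linear space of all gambles on $\Omega$. Write $f\geq g$ for the pointwise ordering, and $f>g$ iff $f\geq g$ and $f\neq g$. A set $\mathcal{R}\subseteq\mathcal{G}(\Omega)$ is coherent if: $0\notin\mathcal{R}$; $f>0$ implies $f\in\mathcal{R}$; $f\in\mathcal{R}$ and $\lambda>0$ imply $\lambda f\in\mathcal{R}$; $f_1,f_2\in\mathcal{R}$ implies $f_1+f_2\in\mathcal{R}$. For a permutation $\pi$ of $\{1,\dots,N\}$ put $\pi(x_1,\dots,x_N)=(x_{\pi(1)},\dots,x_{\pi(N)})$ and $\pi^tf=f\circ\pi$. A coherent set $\mathcal{R}\subseteq\mathcal{G}(\mathcal{X}^N)$ is exchangeable if $h+(f-\pi^tf)\in\mathcal{R}$ for all $h\in\mathcal{R}$, $f\in\mathcal{G}(\mathcal{X}^N)$ and all permutations $\pi$. For $x\in\mathcal{X}^{\check n}$, the count vector $T^{\check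 n}(x)\in\mathbb{Z}_{\geq0}^{\mathcal{X}}$ has components $T^{\check n}_z(x)=|\{k:x_k=z\}|$; for a count vector $\check m$ with total $\check n$, $[\check m]=\{x\in\mathcal{X}^{\check n}:T^{\check n}(x)=\check m\}$. Put $C_{\check x}=\{\check x\}\times\mathcal{X}^{\hat n}$ and $C_{\check m}=[\check m]\times\mathcal{X}^{\hat n}$, subsets of $\mathcal{X}^N$. With $I_C$ the indicator of $C$, and $f\in\mathcal{G}(\mathcal{X}^{\hat n})$, $fI_C$ denotes the gamble $(y,z)\mapsto f(z)I_C(y,z)$ on $\mathcal{X}^N=\mathcal{X}^{\check n}\times\mathcal{X}^{\hat n}$. Define $\mathcal{R}\rfloor\check x=\{f\in\mathcal{G}(\mathcal{X}^{\hat n}):fI_{C_{\check x}}\in\mathcal{R}\}$ and $\mathcal{R}\rfloor\check m=\{f\in\mathcal{G}(\mathcal{X}^{\hat n}):fI_{C_{\check m}}\in\mathcal{R}\}$. *)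

theory Defs
  imports "HOL-Analysis.Analysis" "HOL-Combinatorics.Permutations"
begin

text \<open>Gambles on a set \<open>\<Omega>\<close> are extensional (\<open>undefined\<close> outside \<open>\<Omega>\<close>), so equality of the
  HOL functions is equality of the maps on \<open>\<Omega>\<close>; all operations on gambles are
  pointwise and restricted to \<open>\<Omega>\<close>.\<close>

definition gambles :: "'w set \<Rightarrow> ('w \<Rightarrow> real) set" where
  "gambles \<Omega> = {f \<in> extensional \<Omega>. bounded (f ` \<Omega>)}"

definition gamble_zero :: "'w set \<Rightarrow> 'w \<Rightarrow> real" where
  "gamble_zero \<Omega> = (\<lambda>\<omega>\<in>\<Omega>. 0)"

definition gamble_add :: "'w set \<Rightarrow> ('w \<Rightarrow> real) \<Rightarrow> ('w \<Rightarrow> real) \<Rightarrow> 'w \<Rightarrow> real" where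
  "gamble_add \<Omega> f g = (\<lambda>\<omega>\<in>\<Omega>. f \<omega> + g \<omega>)"

definition gamble_diff :: "'w set \<Rightarrow> ('w \<Rightarrow> real) \<Rightarrow> ('w \<Rightarrow> real) \<Rightarrow> 'w \<Rightarrow> real" where
  "gamble_diff \<Omega> f g = (\<lambda>\<omega>\<in>\<Omega>. f \<omega> - g \<omega>)"

definition gamble_scale :: "'w set \<Rightarrow> real \<Rightarrow> ('w \<Rightarrow> real) \<Rightarrow> 'w \<Rightarrow> real" where
  "gamble_scale \<Omega> c f = (\<lambda>\<omega>\<in>\<Omega>. c * f \<omega>)"

definition gamble_gt :: "'w set \<Rightarrow> ('w \<Rightarrow> real) \<Rightarrow> ('w \<Rightarrow> real) \<Rightarrow> bool" where
  "gamble_gt \<Omega> f g \<longleftrightarrow> (\<forall>\<omega>\<in>\<Omega>. f \<omega> \<ge> g \<omega>) \<and> f \<noteq> g"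

definition coherent :: "'w set \<Rightarrow> ('w \<Rightarrow> real) set \<Rightarrow> bool" where
  "coherent \<Omega> R \<longleftrightarrow>
     R \<subseteq> gambles \<Omega> \<and>
     gamble_zero \<Omega> \<notin> R \<and>
     (\<forall>f\<in>gambles \<Omega>. gamble_gt \<Omega> f (gamble_zero \<Omega>) \<longrightarrow> f \<in> R) \<and>
     (\<forall>f\<in>R. \<forall>c>0. gamble_scale \<Omega> c f \<in> R) \<and>
     (\<forall>f\<in>R. \<forall>g\<in>R. gamble_add \<Omega> f g \<in> R)"

text \<open>The elements of \<open>X\<^sup>n\<close> are the lists of length \<open>n\<close> over \<open>X\<close>, with positions
  \<open>0, \<dots>, n - 1\<close> in place of \<open>1, \<dots>, n\<close>. The product of \<open>X\<^sup>k\<close> and \<open>X\<^sup>l\<close> is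
  identified with \<open>X\<^bsup>k+l\<^esup>\<close> by concatenation.\<close>

definition seqs :: "'a set \<Rightarrow> nat \<Rightarrow> 'a list set" where
  "seqs X n = {x. set x \<subseteq> X \<and> length x = n}"

text \<open>For \<open>x\<close> of length \<open>N\<close> and \<open>\<pi>\<close> a permutation of \<open>{..<N}\<close>, entry \<open>k\<close> of
  \<^term>\<open>permute_list \<pi> x\<close> is \<open>x ! \<pi> k\<close>.\<close>

definition gamble_perm :: "'a set \<Rightarrow> nat \<Rightarrow> (nat \<Rightarrow> nat) \<Rightarrow> ('a list \<Rightarrow> real) \<Rightarrow> 'a list \<Rightarrow> real" where
  "gamble_perm X N \<pi> f = (\<lambda>x\<in>seqs X N. f (permute_list \<pi> x))"

definition exchangeable :: "'a set \<Rightarrow> nat \<Rightarrow> ('a list \<Rightarrow> real) set \<Rightarrow> bool" where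
  "exchangeable X N R \<longleftrightarrow>
     (\<forall>h\<in>R. \<forall>f\<in>gambles (seqs X N). \<forall>\<pi>. \<pi> permutes {..<N} \<longrightarrow>
        gamble_add (seqs X N) h (gamble_diff (seqs X N) f (gamble_perm X N \<pi> f)) \<in> R)"

definition count_vec :: "'a set \<Rightarrow> 'a list \<Rightarrow> 'a \<Rightarrow> nat" where
  "count_vec X x = (\<lambda>z\<in>X. card {k. k < length x \<and> x ! k = z})"

definition atom :: "'a set \<Rightarrow> nat \<Rightarrow> ('a \<Rightarrow> nat) \<Rightarrow> 'a list set" where
  "atom X n m = {x \<in> seqs X n. count_vec X x = m}"

definition cylinder :: "'a set \<Rightarrow> nat \<Rightarrow> 'a list set \<Rightarrow> 'a list set" where
  "cylinder X nh A = {y @ z | y z. y \<in> A \<and> z \<in> seqs X nh}"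

text \<open>The gamble \<open>f I\<^sub>C\<close>: a sequence of length \<open>nc + nh\<close> is the pair \<open>(y, z)\<close> of its
  first \<open>nc\<close> and its last \<open>nh\<close> entries, and \<open>f\<close> acts on \<open>z\<close>.\<close>

definition gamble_ind ::
    "'a set \<Rightarrow> nat \<Rightarrow> nat \<Rightarrow> ('a list \<Rightarrow> real) \<Rightarrow> 'a list set \<Rightarrow> 'a list \<Rightarrow> real" where
  "gamble_ind X nc nh f C = (\<lambda>w\<in>seqs X (nc + nh). f (drop nc w) * indicator C w)"

definition update_sample ::
    "'a set \<Rightarrow> nat \<Rightarrow> nat \<Rightarrow> ('a list \<Rightarrow> real) set \<Rightarrow> 'a list \<Rightarrow> ('a list \<Rightarrow> real) set" where
  "update_sample X nc nh R x =
     {f \<in> gambles (seqs X nh). gamble_ind X nc nh f (cylinder X nh {x}) \<in> R}"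

definition update_count ::
    "'a set \<Rightarrow> nat \<Rightarrow> nat \<Rightarrow> ('a list \<Rightarrow> real) set \<Rightarrow> ('a \<Rightarrow> nat) \<Rightarrow> ('a list \<Rightarrow> real) set" where
  "update_count X nc nh R m =
     {f \<in> gambles (seqs X nh). gamble_ind X nc nh f (cylinder X nh (atom X nc m)) \<in> R}"

end

theory Submission imports Defs begin

text \<open>If \<open>y\<close> is a rearrangement of \<open>x\<close> then \<open>f I\<^sub>C\<close> for \<open>C = C\<^sub>x\<close> is \<open>\<pi>\<^sup>t\<close> of \<open>f I\<^sub>C\<close> for
  \<open>C = C\<^sub>y\<close>, with \<open>\<pi>\<close> a permutation of the first positions only, so exchangeability
  allows exchanging the two inside \<open>R\<close>. Now \<open>f I\<^sub>C\<close> for \<open>C = C\<^sub>m\<close> is the sum of the \<open>f I\<^sub>C\<close>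
  for \<open>C = C\<^sub>u\<close> with \<open>u\<close> in the atom \<open>[m]\<close>; exchanging every summand for the one
  of \<open>y\<close> turns it into a positive multiple of the gamble of \<open>y\<close>.\<close>

section \<open>Count vectors, multisets and rearrangements\<close>

lemma count_vec_eq_count_mset:
  assumes "z \<in> X"
  shows "count_vec X x z = count (mset x) z"
proof -
  have "count (mset x) z = card {k. k < length x \<and> z = x ! k}"
    by (simp add: count_mset count_list_eq_length_filter length_filter_conv_card)
  also have "{k. k < length x \<and> z = x ! k} = {k. k < length x \<and> x ! k = z}"
    by blast
  finally show ?thesis using assms by (simp add: count_vec_def)
qed

text \<open>A count vector sees multiplicities only on \<open>X\<close>; since both lists take their
  entries in \<open>X\<close>, all other multiplicities vanish and nothing is lost. Conversely,
  count vectors are extensional, so agreement on \<open>X\<close> is equality.\<close>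

lemma count_vec_eq_iff_mset_eq:
  assumes "set x \<subseteq> X" "set y \<subseteq> X"
  shows "count_vec X x = count_vec X y \<longleftrightarrow> mset x = mset y"
proof
  assume *: "count_vec X x = count_vec X y"
  show "mset x = mset y"
  proof (rule multiset_eqI)
    fix z
    show "count (mset x) z = count (mset y) z"
    proof (cases "z \<in> X")
      case True
      then show ?thesis using * by (metis count_vec_eq_count_mset)
    next
      case False
      then have "z \<notin> set x" "z \<notin> set y" using assms by auto
      then show ?thesis by (metis count_mset_0_iff)
    qed
  qed
next
  assume "mset x = mset y"
  moreover have "count_vec X x \<in> extensional X" "count_vec X y \<in> extensional X"
    by (simp_all add: count_vec_def)
  ultimately show "count_vec X x = count_vec X y"
    by (intro extensionalityI[of _ X]) (auto simp: count_vec_eq_count_mset)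
qed

lemma permute_list_iff_count_vec:
  assumes "x \<in> seqs X n" "y \<in> seqs X n"
  shows "(\<exists>\<pi>. \<pi> permutes {..<n} \<and> y = permute_list \<pi> x) \<longleftrightarrow> count_vec X x = count_vec X y"
proof -
  have len: "length x = n" using assms by (simp add: seqs_def)
  have "(\<exists>\<pi>. \<pi> permutes {..<n} \<and> y = permute_list \<pi> x) \<longleftrightarrow> mset y = mset x"
  proof
    assume "\<exists>\<pi>. \<pi> permutes {..<n} \<and> y = permute_list \<pi> x"
    then show "mset y = mset x" using len by auto
  next
    assume "mset y = mset x"
    then show "\<exists>\<pi>. \<pi> permutes {..<n} \<and> y = permute_list \<pi> x"
      using len by (elim mset_eq_permutation) auto
  qed
  then show ?thesis
    using assms count_vec_eq_iff_mset_eq[of x X y] by (auto simp: seqs_def)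
qed

section \<open>Splitting and permuting sequences\<close>

lemma finite_seqs: "finite X \<Longrightarrow> finite (seqs X n)"
  by (simp add: seqs_def finite_lists_length_eq)

lemma seqs_take: "w \<in> seqs X (k + l) \<Longrightarrow> take k w \<in> seqs X k"
  by (auto simp: seqs_def dest: in_set_takeD)

lemma seqs_drop: "w \<in> seqs X (k + l) \<Longrightarrow> drop k w \<in> seqs X l"
  by (auto simp: seqs_def dest: in_set_dropD)

lemma permute_list_seqs:
  assumes "\<pi> permutes {..<n}" "w \<in> seqs X n"
  shows "permute_list \<pi> w \<in> seqs X n"
  using assms by (auto simp: seqs_def)

lemma permute_list_inj:
  fixes x y :: "'a list"
  assumes "\<pi> permutes {..<n}" "length x = n" "length y = n"
    and "permute_list \<pi> x = permute_list \<pi> y"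
  shows "x = y"
proof -
  \<comment> \<open>\<open>permute_list\<close> reverses composition: the left factor acts first.
    Hence \<open>inv \<pi>\<close> undoes \<open>\<pi>\<close>.\<close>
  have inv: "permute_list (\<pi> \<circ> inv \<pi>) z = permute_list (inv \<pi>) (permute_list \<pi> z)"
    if "length z = n" for z :: "'a list"
    using that permutes_inv[OF assms(1)] by (intro permute_list_compose) simp
  have "permute_list (\<pi> \<circ> inv \<pi>) x = permute_list (\<pi> \<circ> inv \<pi>) y"
    using assms(4) inv[OF assms(2)] inv[OF assms(3)] by simp
  then show ?thesis using permutes_inv_o(1)[OF assms(1)] by simp
qed

text \<open>\<open>\<pi>\<close> maps the positions below \<open>k\<close> among themselves and
  fixes all others, so the observed block is permuted and the remaining block stays as it
  is.\<close>

lemma permute_list_take_drop: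
  assumes "\<pi> permutes {..<k}" "length w = k + l"
  shows "take k (permute_list \<pi> w) = permute_list \<pi> (take k w)"
    and "drop k (permute_list \<pi> w) = drop k w"
proof -
  have lt: "i < k \<Longrightarrow> \<pi> i < k" for i
    using permutes_in_image[OF assms(1), of i] by simp
  show "take k (permute_list \<pi> w) = permute_list \<pi> (take k w)"
    using assms lt by (intro nth_equalityI) (auto simp: permute_list_def)
  show "drop k (permute_list \<pi> w) = drop k w"
    using assms permutes_not_in[OF assms(1)]
    by (intro nth_equalityI) (auto simp: permute_list_def)
qed

section \<open>Gambles supported on cylinders\<close>

lemma gamble_ind_cylinder:
  assumes "A \<subseteq> seqs X nc" "w \<in> seqs X (nc + nh)"
  shows "gamble_ind X nc nh f (cylinder X nh A) w = (if take nc w \<in> A then f (drop nc w) else 0)"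
proof -
  have "w \<in> cylinder X nh A \<longleftrightarrow> take nc w \<in> A"
  proof
    assume "w \<in> cylinder X nh A"
    then obtain u z where "w = u @ z" "u \<in> A" by (auto simp: cylinder_def)
    \<comment> \<open>The fixed length \<open>nc\<close> makes the splitting of \<open>w\<close>
      unique, so \<open>u\<close> is the prefix \<open>take nc w\<close>.\<close>
    moreover from this have "length u = nc" using assms(1) by (auto simp: seqs_def)
    ultimately show "take nc w \<in> A" by simp
  next
    assume "take nc w \<in> A"
    then show "w \<in> cylinder X nh A"
      unfolding cylinder_def using seqs_drop[OF assms(2)] append_take_drop_id[of nc w, symmetric]
      by blast
  qed
  then show ?thesis using assms(2) by (simp add: gamble_ind_def)
qed

lemma gamble_ind_in_gambles:
  assumes "finite X"
  shows "gamble_ind X nc nh f C \<in> gambles (seqs X (nc + nh))"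
  using finite_seqs[OF assms, of "nc + nh"]
  by (auto simp: gambles_def gamble_ind_def intro!: finite_imp_bounded)

text \<open>\<open>\<pi>\<close> leaves the last \<open>nh\<close> entries of \<open>w\<close>
  alone, so \<open>f\<close> sees the same argument on both sides; the two cylinder conditions agree
  because permuting lists is injective.\<close>

lemma gamble_perm_gamble_ind:
  assumes x: "x \<in> seqs X nc" and \<pi>: "\<pi> permutes {..<nc}"
  shows "gamble_perm X (nc + nh) \<pi> (gamble_ind X nc nh f (cylinder X nh {permute_list \<pi> x})) =
         gamble_ind X nc nh f (cylinder X nh {x})" (is "?l = ?r")
proof (rule extensionalityI)
  show "?l \<in> extensional (seqs X (nc + nh))" by (simp add: gamble_perm_def)
  show "?r \<in> extensional (seqs X (nc + nh))" by (simp add: gamble_ind_def)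
  fix w assume w: "w \<in> seqs X (nc + nh)"
  have \<pi>': "\<pi> permutes {..<nc + nh}" using \<pi> by (rule permutes_subset) auto
  have len: "length w = nc + nh" "length x = nc" using w x by (auto simp: seqs_def)
  have "permute_list \<pi> (take nc w) = permute_list \<pi> x \<longleftrightarrow> take nc w = x"
    using permute_list_inj[OF \<pi>, of "take nc w" x] len by auto
  then show "?l w = ?r w"
    using w x \<pi> \<pi>' len permute_list_seqs[OF \<pi>' w] permute_list_seqs[OF \<pi> x]
      permute_list_take_drop[OF \<pi> len(1)]
    by (simp add: gamble_perm_def gamble_ind_cylinder)
qed

section \<open>Finite sums and exchanges inside \<open>R\<close>\<close>

lemma coherent_sum:
  assumes coh: "coherent \<Omega> R" and "finite B" "B \<noteq> {}" and "\<And>u. u \<in> B \<Longrightarrow> g u \<in> R"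
  shows "(\<lambda>w\<in>\<Omega>. \<Sum>u\<in>B. g u w) \<in> R"
  using assms(2-4)
\<comment> \<open>The induction starts at singletons because the empty sum is the zero gamble, which
  coherence keeps out of \<open>R\<close>.\<close>
proof (induction B rule: finite_ne_induct)
  case (singleton u)
  have "g u \<in> extensional \<Omega>"
    using singleton coh by (auto simp: coherent_def gambles_def)
  then have "(\<lambda>w\<in>\<Omega>. \<Sum>u\<in>{u}. g u w) = g u" by (simp add: extensional_restrict)
  then show ?case using singleton by simp
next
  case (insert u B)
  have "g u \<in> R" "(\<lambda>w\<in>\<Omega>. \<Sum>u\<in>B. g u w) \<in> R"
    using insert.prems insert.IH by blast+
  then have "gamble_add \<Omega> (g u) (\<lambda>w\<in>\<Omega>. \<Sum>u\<in>B. g u w) \<in> R"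
    using coh unfolding coherent_def by blast
  moreover have "gamble_add \<Omega> (g u) (\<lambda>w\<in>\<Omega>. \<Sum>u\<in>B. g u w) = (\<lambda>w\<in>\<Omega>. \<Sum>u\<in>insert u B. g u w)"
    using insert by (auto simp: gamble_add_def)
  ultimately show ?case by (simp only:)
qed

text \<open>Iterated exchangeability: each difference is added to an element already in
  \<open>R\<close>, so the permutation may vary with \<open>u\<close>, and \<open>B\<close> may be
  empty because \<open>h\<close> itself is in \<open>R\<close>.\<close>

lemma exchangeable_sum:
  assumes ex: "exchangeable X N R" and h: "h \<in> R" "h \<in> extensional (seqs X N)"
    and "finite B" and "\<And>u. u \<in> B \<Longrightarrow> g u \<in> gambles (seqs X N)"
    and "\<And>u. u \<in> B \<Longrightarrow> \<exists>\<pi>. \<pi> permutes {..<N} \<and> gamble_perm X N \<pi> (g u) = g' u"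
  shows "(\<lambda>w\<in>seqs X N. h w + (\<Sum>u\<in>B. g u w - g' u w)) \<in> R"
  using assms(4-6)
proof (induction B rule: finite_induct)
  case empty
  then show ?case using h by (simp add: extensional_restrict)
next
  case (insert u B)
  let ?k = "\<lambda>w\<in>seqs X N. h w + (\<Sum>u\<in>B. g u w - g' u w)"
  obtain \<pi> where \<pi>: "\<pi> permutes {..<N}" "gamble_perm X N \<pi> (g u) = g' u"
    using insert.prems by blast
  have gu: "g u \<in> gambles (seqs X N)" using insert.prems(1) by blast
  have k: "?k \<in> R" using insert.prems insert.IH by blast
  have "gamble_add (seqs X N) ?k (gamble_diff (seqs X N) (g u) (gamble_perm X N \<pi> (g u))) \<in> R"
    using ex[unfolded exchangeable_def, rule_format, OF k gu \<pi>(1)] .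
  then have "gamble_add (seqs X N) ?k (gamble_diff (seqs X N) (g u) (g' u)) \<in> R"
    by (simp only: \<pi>(2))
  moreover have "gamble_add (seqs X N) ?k (gamble_diff (seqs X N) (g u) (g' u)) =
      (\<lambda>w\<in>seqs X N. h w + (\<Sum>u\<in>insert u B. g u w - g' u w))"
    using insert.hyps by (auto simp: gamble_add_def gamble_diff_def)
  ultimately show ?case by (simp only:)
qed

section \<open>Comparing the updated sets\<close>

lemma gamble_ind_rearrange:
  assumes "x \<in> seqs X nc" "y \<in> seqs X nc" "count_vec X x = count_vec X y"
  shows "\<exists>\<pi>. \<pi> permutes {..<nc + nh} \<and>
    gamble_perm X (nc + nh) \<pi> (gamble_ind X nc nh f (cylinder X nh {y})) =
    gamble_ind X nc nh f (cylinder X nh {x})"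
proof -
  obtain \<pi> where \<pi>: "\<pi> permutes {..<nc}" "y = permute_list \<pi> x"
    using permute_list_iff_count_vec[OF assms(1,2)] assms(3) by blast
  moreover have "\<pi> permutes {..<nc + nh}" using \<pi>(1) by (rule permutes_subset) auto
  ultimately show ?thesis using gamble_perm_gamble_ind[OF assms(1) \<pi>(1)] by blast
qed

lemma update_sample_subset:
  assumes "finite X" "exchangeable X (nc + nh) R"
    and "x \<in> seqs X nc" "y \<in> seqs X nc" "count_vec X x = count_vec X y"
  shows "update_sample X nc nh R x \<subseteq> update_sample X nc nh R y"
proof
  fix f assume f: "f \<in> update_sample X nc nh R x"
  let ?g = "\<lambda>u. gamble_ind X nc nh f (cylinder X nh {u})"
  have ext: "?g u \<in> extensional (seqs X (nc + nh))" for u by (simp add: gamble_ind_def)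
  \<comment> \<open>A single exchange: \<open>?g x\<close> cancels and \<open>?g y\<close> is
    left.\<close>
  have "(\<lambda>w\<in>seqs X (nc + nh). ?g x w + (\<Sum>u\<in>{y}. ?g u w - ?g x w)) \<in> R"
    using assms f gamble_ind_rearrange[OF assms(3-5)] gamble_ind_in_gambles ext
    by (intro exchangeable_sum) (auto simp: update_sample_def)
  then show "f \<in> update_sample X nc nh R y"
    using f by (simp add: update_sample_def extensional_restrict ext)
qed

text \<open>The cylinders of the members of the atom are pairwise disjoint with union the cylinder
  of the atom: at \<open>w\<close> only the summand \<open>u = take nc w\<close> can be
  nonzero.\<close>

lemma gamble_ind_atom:
  assumes "finite X"
  shows "gamble_ind X nc nh f (cylinder X nh (atom X nc m)) =
    (\<lambda>w\<in>seqs X (nc + nh). \<Sum>u\<in>atom X nc m. gamble_ind X nc nh f (cylinder X nh {u}) w)"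
    (is "?l = ?r")
proof (rule extensionalityI)
  show "?l \<in> extensional (seqs X (nc + nh))" by (simp add: gamble_ind_def)
  show "?r \<in> extensional (seqs X (nc + nh))" by simp
  fix w assume w: "w \<in> seqs X (nc + nh)"
  have sub: "atom X nc m \<subseteq> seqs X nc" by (auto simp: atom_def)
  have fin: "finite (atom X nc m)" using sub finite_seqs[OF assms] by (rule finite_subset)
  have "(\<Sum>u\<in>atom X nc m. gamble_ind X nc nh f (cylinder X nh {u}) w) =
      (\<Sum>u\<in>atom X nc m. if take nc w = u then f (drop nc w) else 0)"
    using sub w by (intro sum.cong) (auto simp: gamble_ind_cylinder)
  then show "?l w = ?r w"
    using w fin sub by (simp add: gamble_ind_cylinder)
qed

lemma update_sample_eq_update_count:
  assumes "finite X" and coh: "coherent (seqs X (nc + nh)) R"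
    and ex: "exchangeable X (nc + nh) R" and y: "y \<in> atom X nc m"
  shows "update_sample X nc nh R y = update_count X nc nh R m"
proof (intro set_eqI iffI)
  have sub: "atom X nc m \<subseteq> seqs X nc" by (auto simp: atom_def)
  have fin: "finite (atom X nc m)" using sub finite_seqs[OF assms(1)] by (rule finite_subset)
  {
    fix f assume f: "f \<in> update_sample X nc nh R y"
    \<comment> \<open>All members of the atom are rearrangements of \<open>y\<close>, so every
      summand of the atom's gamble lies in \<open>R\<close>.\<close>
    have "f \<in> update_sample X nc nh R u" if "u \<in> atom X nc m" for u
      using update_sample_subset[OF assms(1) ex, of y u] f y that by (auto simp: atom_def)
    then have "(\<lambda>w\<in>seqs X (nc + nh).
        \<Sum>u\<in>atom X nc m. gamble_ind X nc nh f (cylinder X nh {u}) w) \<in> R"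
      using fin y by (intro coherent_sum[OF coh]) (auto simp: update_sample_def)
    then show "f \<in> update_count X nc nh R m"
      using f by (simp add: update_count_def update_sample_def gamble_ind_atom[OF assms(1)])
  next
    fix f assume f: "f \<in> update_count X nc nh R m"
    let ?\<Omega> = "seqs X (nc + nh)"
    let ?g = "\<lambda>u. gamble_ind X nc nh f (cylinder X nh {u})"
    let ?h = "gamble_ind X nc nh f (cylinder X nh (atom X nc m))"
    \<comment> \<open>Since \<open>?h\<close> is the sum of the \<open>?g u\<close>, these cancel
      and \<open>?k\<close> is \<open>?g y\<close> times the number of members of the atom.\<close>
    let ?k = "\<lambda>w\<in>?\<Omega>. ?h w + (\<Sum>u\<in>atom X nc m. ?g y w - ?g u w)"
    have "?k \<in> R"
    proof (rule exchangeable_sum[OF ex _ _ fin])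
      show "?h \<in> R" using f by (simp add: update_count_def)
      show "?h \<in> extensional ?\<Omega>" by (simp add: gamble_ind_def)
      show "?g y \<in> gambles ?\<Omega>" by (rule gamble_ind_in_gambles[OF assms(1)])
      fix u assume "u \<in> atom X nc m"
      then show "\<exists>\<pi>. \<pi> permutes {..<nc + nh} \<and> gamble_perm X (nc + nh) \<pi> (?g y) = ?g u"
        using y by (intro gamble_ind_rearrange) (auto simp: atom_def)
    qed
    \<comment> \<open>Because \<open>y\<close> is in the atom, the number of members is positive and
      its reciprocal is an admissible scaling factor.\<close>
    moreover have card: "card (atom X nc m) > 0" using fin y by (auto simp: card_gt_0_iff)
    ultimately have "gamble_scale ?\<Omega> (1 / card (atom X nc m)) ?k \<in> R"
      using coh by (simp add: coherent_def)
    also have "gamble_scale ?\<Omega> (1 / card (atom X nc m)) ?k = ?g y"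
    proof (rule extensionalityI)
      show "gamble_scale ?\<Omega> (1 / card (atom X nc m)) ?k \<in> extensional ?\<Omega>"
        by (simp add: gamble_scale_def)
      show "?g y \<in> extensional ?\<Omega>" by (simp add: gamble_ind_def)
      fix w assume "w \<in> ?\<Omega>"
      then show "gamble_scale ?\<Omega> (1 / card (atom X nc m)) ?k w = ?g y w"
        using card by (simp add: gamble_scale_def gamble_ind_atom[OF assms(1)] sum_subtractf)
    qed
    finally show "f \<in> update_sample X nc nh R y"
      using f by (simp add: update_count_def update_sample_def)
  }
qed

theorem proposition16:
  fixes X :: "'a set" and nc nh N :: nat
    and x y :: "'a list" and R :: "('a list \<Rightarrow> real) set"
  assumes "finite X" and "X \<noteq> {}"
    and "nc \<ge> 1" and "nh \<ge> 1" and "N = nc + nh"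
    and "x \<in> seqs X nc" and "y \<in> seqs X nc"
    and "coherent (seqs X N) R" and "exchangeable X N R"
  shows "((\<exists>\<pi>. \<pi> permutes {..<nc} \<and> y = permute_list \<pi> x) \<longleftrightarrow> count_vec X x = count_vec X y) \<and>
    (\<forall>m. count_vec X x = m \<and> count_vec X y = m \<longrightarrow>
       update_sample X nc nh R x = update_sample X nc nh R y \<and>
       update_sample X nc nh R y = update_count X nc nh R m)"
proof (intro conjI allI impI)
  show "(\<exists>\<pi>. \<pi> permutes {..<nc} \<and> y = permute_list \<pi> x) \<longleftrightarrow> count_vec X x = count_vec X y"
    using assms(6,7) by (rule permute_list_iff_count_vec)
  fix m assume "count_vec X x = m \<and> count_vec X y = m"
  then have "x \<in> atom X nc m" "y \<in> atom X nc m"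
    using assms(6,7) by (auto simp: atom_def)
  moreover have "coherent (seqs X (nc + nh)) R" "exchangeable X (nc + nh) R"
    using assms(5,8,9) by simp_all
  \<comment> \<open>Both samples lie in the atom of \<open>m\<close>, so both updated sets equal the
    one for \<open>m\<close>.\<close>
  ultimately show "update_sample X nc nh R x = update_sample X nc nh R y"
    and "update_sample X nc nh R y = update_count X nc nh R m"
    using update_sample_eq_update_count[OF assms(1)] by blast+
qed

end
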